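(* Assume that conditions (A1)-(A4) in the context hold, and suppose that an $x^k\in\mathfrak{F}$ is given at some iteration $k\ge0$ of Algorithm IR (defined in the context). Then $\sigma_k>0$, so that the tolerance $\epsilon_k>0$ in Step 2 can be chosen; the feasible set of the subproblem $\min_{x\in\mathbb{R}^n}\{\|w^k\circ x\|_1:\|A_kx-b^k\|^2\le\sigma_k\}$ is nonempty, and $A^\dagger b$ is a Slater point of it (i.e. $\|A_kA^\dagger b-b^k\|^2<\sigma_k$); a pair $(\tilde x^{k+1},\tilde u^{k+1})$ satisfying (C1), (C2) and (C3) exists; and $x^{k+1}=P_k(\tilde x^{k+1})\in\mathfrak{F}$. Consequently, Algorithm IR is well defined.
   Context: Problem (P): minimize $\sum_{i=1}^n\psi(|x_i|)$ over $x\in\mathbb{R}^n$ subject to $\sum_{i=1}^m\phi((b_i-a_i^Tx)^2)\le\sigma$. Here $A\in\mathbb{R}^{m\times n}$ has $i$th row $a_i^T$, $b\in\mathbb{R}^m$ and $\sigma>0$. Assumptions: (A1) $\psi:\mathbb{R}_+\to\mathbb{R}_+$ is continuous and strictly concave with $\psi(0)=0$ and $\lim_{t\to\infty}\psi(t)=\infty$; it is differentiable on $(0,\infty)$ with $\psi'(t)>0$ for all $t>0$, and $\lim_{t\downarrow0}\psi'(t)$ exists and belongs to $(0,\infty)$. (A2) $\phi:\mathbb{R}_+\to\mathbb{R}_+$ is continuous and concave with $\phi(0)=0$; it is differentiable on $(0,\infty)$ with $\phi'(t)\ge0$ for all $t>0$, and $\lim_{t\downarrow0}\phi'(t)$ exists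 and belongs to $(0,\infty)$. (A3) $A$ has full row rank and $\sigma\in(0,\sum_{i=1}^m\phi(b_i^2))$. (A4) $\sigma\notin\{k\overline\phi: k=1,\dots,m\}$, where $\overline\phi:=\sup_{t\in\mathbb{R}_+}\phi(t)\in(0,\infty]$. Notation: $\psi'_+,\phi'_+:\mathbb{R}_+\to\mathbb{R}$ are the right-hand derivatives. For $u\in\mathbb{R}^n_+$, $v\in\mathbb{R}^m_+$: $\Psi(u)=\sum_{i=1}^n\psi(u_i)$, $\Phi(v)=\sum_{i=1}^m\phi(v_i)$, $\Psi'_+(u)=(\psi'_+(u_1),\dots,\psi'_+(u_n))$, $\Phi'_+(v)=(\phi'_+(v_1),\dots,\phi'_+(v_m))$. The feasible set is $\mathfrak{F}=\{x\in\mathbb{R}^n:\Phi((b-Ax)\circ(b-Ax))\le\sigma\}$. $\circ$ is the entrywise product, $|x|$ and $\sqrt{x}$ are taken entrywise, $\|\cdot\|$ is the Euclidean norm, $A^\dagger$ is the Moore-Penrose pseudoinverse. $\partial\|x\|_1$ is the convex subdifferential of the $\ell_1$ norm at $x$, and $w\circ\partial\|x\|_1=\{w\circ s:s\in\partial\|x\|_1\}$. $N_{\|\cdot\|^2\le\sigma_k}(u)$ is the normal cone at $u$ of the set $\{z\in\mathbb{R}^m:\|z\|^2\le\sigma_k\}$ (empty if $u$ is not in this set); the distance to the empty set is $+\infty$. Algorithm IR: Pick a positive sequence $\{\tau_k\}$ with $\tau_k\downarrow0$, a summable positive sequence $\{\mu_k\}$, and $x^0\in\mathfrak{F}$. For $k=0,1,2,\dots$: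 Step 1. Set $w^k=\Psi'_+(|x^k|)$, $y^k=b-Ax^k$, $v^k=\sqrt{\Phi'_+(y^k\circ y^k)}$, $A_k=\mathrm{Diag}(v^k)A$, $b^k=v^k\circ b$, $\sigma_k=\sigma+\|b^k-A_kx^k\|^2-\Phi(y^k\circ y^k)$. Step 2. Pick any $\epsilon_k\in(0,\min\{\sigma_k,\sqrt{\sigma_k},\tau_k\}]$ and approximately solve the subproblem $\min_x\|w^k\circ x\|_1$ s.t. $\|A_kx-b^k\|^2\le\sigma_k$ by finding a pair $(\tilde x^{k+1},\tilde u^{k+1})\in\mathbb{R}^n\times\mathbb{R}^m$ satisfying (C1) $\mathrm{dist}(0,\,w^k\circ\partial\|\tilde x^{k+1}\|_1+A_k^TN_{\|\cdot\|^2\le\sigma_k}(\tilde u^{k+1}))\le\epsilon_k$, (C2) $\|A_k\tilde x^{k+1}-b^k-\tilde u^{k+1}\|\le\epsilon_k$, (C3) $\|w^k\circ P_k(\tilde x^{k+1})\|_1\le\|w^k\circ x^k\|_1+\mu_k$, where $P_k(x)=x$ if $\|A_kx-b^k\|^2\le\sigma_k$, and otherwise $P_k(x)=\left(1-\frac{\sqrt{\sigma_k}}{\|A_kx-b^k\|}\right)A^\dagger b+\frac{\sqrt{\sigma_k}}{\|A_kx-b^k\|}x$. Step 3. Set $x^{k+1}=P_k(\tilde x^{k+1})$. "Well defined" means that starting from any $x^0\in\mathfrak{F}$, every step of the algorithm can be carried out for every $k\ge0$. *)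

theory Defs
  imports "HOL-Analysis.Analysis"
begin

text \<open>
  On \<^typ>\<open>real ^ 'n\<close> the library operations \<open>*\<close> and \<open>\<bar>_\<bar>\<close> act entrywise; \<open>*\<close> is used below for the
  entrywise product of vectors.  A function on the nonnegative reals is a \<^typ>\<open>real \<Rightarrow> real\<close> whose
  values at negative arguments are irrelevant.
\<close>

section \<open>Notions from analysis and linear algebra\<close>

definition strictly_concave_on :: "'a::real_vector set \<Rightarrow> ('a \<Rightarrow> real) \<Rightarrow> bool" where
  "strictly_concave_on S f \<longleftrightarrow> convex S \<and>
     (\<forall>x\<in>S. \<forall>y\<in>S. \<forall>t. x \<noteq> y \<and> 0 < t \<and> t < 1 \<longrightarrow>
        (1 - t) * f x + t * f y < f ((1 - t) *\<^sub>R x + t *\<^sub>R y))"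

definition has_right_deriv :: "(real \<Rightarrow> real) \<Rightarrow> real \<Rightarrow> bool" where
  "has_right_deriv f t \<longleftrightarrow> (\<exists>D. (f has_real_derivative D) (at_right t))"

definition right_deriv :: "(real \<Rightarrow> real) \<Rightarrow> real \<Rightarrow> real" where
  "right_deriv f t = (THE D. (f has_real_derivative D) (at_right t))"

definition right_deriv_vec :: "(real \<Rightarrow> real) \<Rightarrow> real ^ 'n \<Rightarrow> real ^ 'n" where
  "right_deriv_vec f u = (\<chi> i. right_deriv f (u $ i))"

definition l1_norm :: "real ^ 'n \<Rightarrow> real" where
  "l1_norm x = (\<Sum>i\<in>UNIV. \<bar>x $ i\<bar>)"

definition subdifferential :: "('a::real_inner \<Rightarrow> real) \<Rightarrow> 'a \<Rightarrow> 'a set" where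
  "subdifferential f x = {s. \<forall>y. f y \<ge> f x + s \<bullet> (y - x)}"

definition normal_cone :: "'a::real_inner set \<Rightarrow> 'a \<Rightarrow> 'a set" where
  "normal_cone C u = (if u \<in> C then {\<nu>. \<forall>z\<in>C. \<nu> \<bullet> (z - u) \<le> 0} else {})"

text \<open>Unlike \<^const>\<open>infdist\<close>, this is \<open>\<infinity>\<close> (and not \<open>0\<close>) for the empty set.\<close>

definition ext_infdist :: "'a::metric_space \<Rightarrow> 'a set \<Rightarrow> ereal" where
  "ext_infdist x S = (INF s\<in>S. ereal (dist x s))"

definition diag_mat :: "real ^ 'm \<Rightarrow> real ^ 'm ^ 'm" where
  "diag_mat v = (\<chi> i j. if i = j then v $ i else 0)"

definition is_moore_penrose :: "real ^ 'n ^ 'm \<Rightarrow> real ^ 'm ^ 'n \<Rightarrow> bool" where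
  "is_moore_penrose A X \<longleftrightarrow>
     A ** X ** A = A \<and> X ** A ** X = X \<and>
     transpose (A ** X) = A ** X \<and> transpose (X ** A) = X ** A"

definition pinv :: "real ^ 'n ^ 'm \<Rightarrow> real ^ 'm ^ 'n" where
  "pinv A = (THE X. is_moore_penrose A X)"

section \<open>Standing assumptions\<close>

definition assumption_A1 :: "(real \<Rightarrow> real) \<Rightarrow> bool" where
  "assumption_A1 \<psi> \<longleftrightarrow>
     (\<forall>t\<ge>0. 0 \<le> \<psi> t) \<and> continuous_on {0..} \<psi> \<and> strictly_concave_on {0..} \<psi> \<and>
     \<psi> 0 = 0 \<and> filterlim \<psi> at_top at_top \<and>
     (\<forall>t>0. \<psi> differentiable (at t) \<and> 0 < deriv \<psi> t) \<and>
     (\<exists>L>0. (deriv \<psi> \<longlongrightarrow> L) (at_right 0))"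

definition assumption_A2 :: "(real \<Rightarrow> real) \<Rightarrow> bool" where
  "assumption_A2 \<phi> \<longleftrightarrow>
     (\<forall>t\<ge>0. 0 \<le> \<phi> t) \<and> continuous_on {0..} \<phi> \<and> concave_on {0..} \<phi> \<and>
     \<phi> 0 = 0 \<and>
     (\<forall>t>0. \<phi> differentiable (at t) \<and> 0 \<le> deriv \<phi> t) \<and>
     (\<exists>L>0. (deriv \<phi> \<longlongrightarrow> L) (at_right 0))"

definition assumption_A3 :: "(real \<Rightarrow> real) \<Rightarrow> real ^ 'n ^ 'm \<Rightarrow> real ^ 'm \<Rightarrow> real \<Rightarrow> bool" where
  "assumption_A3 \<phi> A b \<sigma> \<longleftrightarrow>
     rank A = CARD('m) \<and> 0 < \<sigma> \<and> \<sigma> < (\<Sum>i\<in>UNIV. \<phi> ((b $ i)\<^sup>2))"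

definition phi_sup :: "(real \<Rightarrow> real) \<Rightarrow> ereal" where
  "phi_sup \<phi> = (SUP t\<in>{0..}. ereal (\<phi> t))"

text \<open>The number \<open>m\<close> of rows is passed explicitly.\<close>

definition assumption_A4 :: "nat \<Rightarrow> (real \<Rightarrow> real) \<Rightarrow> real \<Rightarrow> bool" where
  "assumption_A4 m \<phi> \<sigma> \<longleftrightarrow> ereal \<sigma> \<notin> {ereal (real k) * phi_sup \<phi> | k. k \<in> {1..m}}"

section \<open>The algorithm\<close>

definition Phi :: "(real \<Rightarrow> real) \<Rightarrow> real ^ 'm \<Rightarrow> real" where
  "Phi \<phi> v = (\<Sum>i\<in>UNIV. \<phi> (v $ i))"

definition feasible_set ::
    "(real \<Rightarrow> real) \<Rightarrow> real ^ 'n ^ 'm \<Rightarrow> real ^ 'm \<Rightarrow> real \<Rightarrow> (real ^ 'n) set" where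
  "feasible_set \<phi> A b \<sigma> = {x. Phi \<phi> ((b - A *v x) * (b - A *v x)) \<le> \<sigma>}"

text \<open>The quantities of Step 1, as functions of the current iterate \<open>x\<close>.\<close>

definition ir_w :: "(real \<Rightarrow> real) \<Rightarrow> real ^ 'n \<Rightarrow> real ^ 'n" where
  "ir_w \<psi> x = right_deriv_vec \<psi> \<bar>x\<bar>"

definition ir_y :: "real ^ 'n ^ 'm \<Rightarrow> real ^ 'm \<Rightarrow> real ^ 'n \<Rightarrow> real ^ 'm" where
  "ir_y A b x = b - A *v x"

definition ir_v ::
    "(real \<Rightarrow> real) \<Rightarrow> real ^ 'n ^ 'm \<Rightarrow> real ^ 'm \<Rightarrow> real ^ 'n \<Rightarrow> real ^ 'm" where
  "ir_v \<phi> A b x = (\<chi> i. sqrt (right_deriv_vec \<phi> (ir_y A b x * ir_y A b x) $ i))"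

definition ir_A ::
    "(real \<Rightarrow> real) \<Rightarrow> real ^ 'n ^ 'm \<Rightarrow> real ^ 'm \<Rightarrow> real ^ 'n \<Rightarrow> real ^ 'n ^ 'm" where
  "ir_A \<phi> A b x = diag_mat (ir_v \<phi> A b x) ** A"

definition ir_b ::
    "(real \<Rightarrow> real) \<Rightarrow> real ^ 'n ^ 'm \<Rightarrow> real ^ 'm \<Rightarrow> real ^ 'n \<Rightarrow> real ^ 'm" where
  "ir_b \<phi> A b x = ir_v \<phi> A b x * b"

definition ir_sigma ::
    "(real \<Rightarrow> real) \<Rightarrow> real ^ 'n ^ 'm \<Rightarrow> real ^ 'm \<Rightarrow> real \<Rightarrow> real ^ 'n \<Rightarrow> real" where
  "ir_sigma \<phi> A b \<sigma> x =
     \<sigma> + (norm (ir_b \<phi> A b x - ir_A \<phi> A b x *v x))\<^sup>2 - Phi \<phi> (ir_y A b x * ir_y A b x)"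

text \<open>
  Step 1 is meaningful at \<open>x\<close>: the right-hand derivatives exist, and those of \<open>\<phi>\<close> have a square root.
\<close>

definition ir_step1_defined ::
    "(real \<Rightarrow> real) \<Rightarrow> (real \<Rightarrow> real) \<Rightarrow> real ^ 'n ^ 'm \<Rightarrow> real ^ 'm \<Rightarrow> real ^ 'n \<Rightarrow> bool" where
  "ir_step1_defined \<phi> \<psi> A b x \<longleftrightarrow>
     (\<forall>i. has_right_deriv \<psi> (\<bar>x\<bar> $ i)) \<and>
     (\<forall>i. has_right_deriv \<phi> ((ir_y A b x * ir_y A b x) $ i) \<and>
          0 \<le> right_deriv \<phi> ((ir_y A b x * ir_y A b x) $ i))"

definition subproblem_feasible ::
    "(real \<Rightarrow> real) \<Rightarrow> real ^ 'n ^ 'm \<Rightarrow> real ^ 'm \<Rightarrow> real \<Rightarrow> real ^ 'n \<Rightarrow> (real ^ 'n) set" where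
  "subproblem_feasible \<phi> A b \<sigma> x =
     {z. (norm (ir_A \<phi> A b x *v z - ir_b \<phi> A b x))\<^sup>2 \<le> ir_sigma \<phi> A b \<sigma> x}"

definition ir_P ::
    "(real \<Rightarrow> real) \<Rightarrow> real ^ 'n ^ 'm \<Rightarrow> real ^ 'm \<Rightarrow> real \<Rightarrow> real ^ 'n \<Rightarrow> real ^ 'n \<Rightarrow> real ^ 'n" where
  "ir_P \<phi> A b \<sigma> x z =
     (let \<rho> = sqrt (ir_sigma \<phi> A b \<sigma> x) / norm (ir_A \<phi> A b x *v z - ir_b \<phi> A b x)
      in if (norm (ir_A \<phi> A b x *v z - ir_b \<phi> A b x))\<^sup>2 \<le> ir_sigma \<phi> A b \<sigma> x then z
         else (1 - \<rho>) *\<^sub>R (pinv A *v b) + \<rho> *\<^sub>R z)"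

definition ir_tolerance ::
    "(real \<Rightarrow> real) \<Rightarrow> real ^ 'n ^ 'm \<Rightarrow> real ^ 'm \<Rightarrow> real \<Rightarrow> real \<Rightarrow> real ^ 'n \<Rightarrow> real \<Rightarrow> bool" where
  "ir_tolerance \<phi> A b \<sigma> \<tau>k x \<epsilon> \<longleftrightarrow>
     0 < \<epsilon> \<and> \<epsilon> \<le> Min {ir_sigma \<phi> A b \<sigma> x, sqrt (ir_sigma \<phi> A b \<sigma> x), \<tau>k}"

definition cond_C1 ::
    "(real \<Rightarrow> real) \<Rightarrow> (real \<Rightarrow> real) \<Rightarrow> real ^ 'n ^ 'm \<Rightarrow> real ^ 'm \<Rightarrow> real \<Rightarrow> real ^ 'n \<Rightarrow>
     real \<Rightarrow> real ^ 'n \<Rightarrow> real ^ 'm \<Rightarrow> bool" where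
  "cond_C1 \<phi> \<psi> A b \<sigma> x \<epsilon> xt ut \<longleftrightarrow>
     ext_infdist 0
       {ir_w \<psi> x * s + transpose (ir_A \<phi> A b x) *v \<nu> | s \<nu>.
          s \<in> subdifferential l1_norm xt \<and>
          \<nu> \<in> normal_cone {z. (norm z)\<^sup>2 \<le> ir_sigma \<phi> A b \<sigma> x} ut} \<le> ereal \<epsilon>"

definition cond_C2 ::
    "(real \<Rightarrow> real) \<Rightarrow> real ^ 'n ^ 'm \<Rightarrow> real ^ 'm \<Rightarrow> real ^ 'n \<Rightarrow>
     real \<Rightarrow> real ^ 'n \<Rightarrow> real ^ 'm \<Rightarrow> bool" where
  "cond_C2 \<phi> A b x \<epsilon> xt ut \<longleftrightarrow> norm (ir_A \<phi> A b x *v xt - ir_b \<phi> A b x - ut) \<le> \<epsilon>"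

definition cond_C3 ::
    "(real \<Rightarrow> real) \<Rightarrow> (real \<Rightarrow> real) \<Rightarrow> real ^ 'n ^ 'm \<Rightarrow> real ^ 'm \<Rightarrow> real \<Rightarrow> real ^ 'n \<Rightarrow>
     real \<Rightarrow> real ^ 'n \<Rightarrow> bool" where
  "cond_C3 \<phi> \<psi> A b \<sigma> x \<mu>k xt \<longleftrightarrow>
     l1_norm (ir_w \<psi> x * ir_P \<phi> A b \<sigma> x xt) \<le> l1_norm (ir_w \<psi> x * x) + \<mu>k"

definition ir_pair ::
    "(real \<Rightarrow> real) \<Rightarrow> (real \<Rightarrow> real) \<Rightarrow> real ^ 'n ^ 'm \<Rightarrow> real ^ 'm \<Rightarrow> real \<Rightarrow> real \<Rightarrow>
     real ^ 'n \<Rightarrow> real \<Rightarrow> real ^ 'n \<Rightarrow> real ^ 'm \<Rightarrow> bool" where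
  "ir_pair \<phi> \<psi> A b \<sigma> \<mu>k x \<epsilon> xt ut \<longleftrightarrow>
     cond_C1 \<phi> \<psi> A b \<sigma> x \<epsilon> xt ut \<and> cond_C2 \<phi> A b x \<epsilon> xt ut \<and> cond_C3 \<phi> \<psi> A b \<sigma> x \<mu>k xt"

definition ir_parameters :: "(nat \<Rightarrow> real) \<Rightarrow> (nat \<Rightarrow> real) \<Rightarrow> bool" where
  "ir_parameters \<tau> \<mu> \<longleftrightarrow>
     (\<forall>k. 0 < \<tau> k) \<and> decseq \<tau> \<and> \<tau> \<longlonglongrightarrow> 0 \<and> (\<forall>k. 0 < \<mu> k) \<and> summable \<mu>"

text \<open>One full iteration, taking \<open>x\<close> to \<open>x'\<close> with the choices \<open>\<epsilon>\<close>, \<open>xt\<close>, \<open>ut\<close>.\<close>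

definition ir_iteration ::
    "(real \<Rightarrow> real) \<Rightarrow> (real \<Rightarrow> real) \<Rightarrow> real ^ 'n ^ 'm \<Rightarrow> real ^ 'm \<Rightarrow> real \<Rightarrow> real \<Rightarrow> real \<Rightarrow>
     real ^ 'n \<Rightarrow> real \<Rightarrow> real ^ 'n \<Rightarrow> real ^ 'm \<Rightarrow> real ^ 'n \<Rightarrow> bool" where
  "ir_iteration \<phi> \<psi> A b \<sigma> \<tau>k \<mu>k x \<epsilon> xt ut x' \<longleftrightarrow>
     ir_step1_defined \<phi> \<psi> A b x \<and> ir_tolerance \<phi> A b \<sigma> \<tau>k x \<epsilon> \<and>
     ir_pair \<phi> \<psi> A b \<sigma> \<mu>k x \<epsilon> xt ut \<and> x' = ir_P \<phi> A b \<sigma> x xt"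

text \<open>
  Well-definedness: whatever choices were made in the first \<open>N\<close> iterations, every step of iteration \<open>N\<close>
  can be carried out, for every admissible tolerance; and from every feasible starting point
  there is an infinite run.
\<close>

definition ir_well_defined ::
    "(real \<Rightarrow> real) \<Rightarrow> (real \<Rightarrow> real) \<Rightarrow> real ^ 'n ^ 'm \<Rightarrow> real ^ 'm \<Rightarrow> real \<Rightarrow>
     (nat \<Rightarrow> real) \<Rightarrow> (nat \<Rightarrow> real) \<Rightarrow> bool" where
  "ir_well_defined \<phi> \<psi> A b \<sigma> \<tau> \<mu> \<longleftrightarrow>
     (\<forall>N X E Xt Ut.
        X 0 \<in> feasible_set \<phi> A b \<sigma> \<and>
        (\<forall>k<N. ir_iteration \<phi> \<psi> A b \<sigma> (\<tau> k) (\<mu> k) (X k) (E k) (Xt k) (Ut k) (X (Suc k))) \<longrightarrow>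
        ir_step1_defined \<phi> \<psi> A b (X N) \<and>
        (\<exists>\<epsilon>. ir_tolerance \<phi> A b \<sigma> (\<tau> N) (X N) \<epsilon>) \<and>
        (\<forall>\<epsilon>. ir_tolerance \<phi> A b \<sigma> (\<tau> N) (X N) \<epsilon> \<longrightarrow>
           (\<exists>xt ut. ir_pair \<phi> \<psi> A b \<sigma> (\<mu> N) (X N) \<epsilon> xt ut))) \<and>
     (\<forall>x0 \<in> feasible_set \<phi> A b \<sigma>. \<exists>X E Xt Ut. X 0 = x0 \<and>
        (\<forall>k. ir_iteration \<phi> \<psi> A b \<sigma> (\<tau> k) (\<mu> k) (X k) (E k) (Xt k) (Ut k) (X (Suc k))))"

end

theory Submission
  imports Defs
begin

text \<open>
  By concavity, \<open>\<phi> s \<le> \<phi> t + \<phi>'\<^sub>+ t * (s - t)\<close> for all \<open>s, t \<ge> 0\<close>.  Summed over the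
  coordinates, this majorization shows that every point of the subproblem's feasible set is feasible
  for the original problem.  With \<open>s = 0\<close> it gives \<open>\<sigma>\<^sub>k \<ge> 0\<close>; equality would force
  \<open>\<phi>'\<^sub>+ t\<^sub>i = 0\<close>, hence \<open>\<phi> t\<^sub>i = sup \<phi>\<close>, at every nonzero \<open>t\<^sub>i = (y\<^sub>i)\<^sup>2\<close>, so \<open>\<sigma>\<close> would be a
  multiple of \<open>sup \<phi>\<close>, which (A4) excludes.  Full row rank gives \<open>A A\<^sup>\<dagger> b = b\<close>, so the residual of
  the subproblem vanishes at \<open>A\<^sup>\<dagger> b\<close>, and \<open>P\<^sub>k\<close> rescales residuals onto the sphere of radius
  \<open>sqrt \<sigma>\<^sub>k\<close>.  Since all weights are positive, the subproblem has an exact solution; its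
  Karush-Kuhn-Tucker conditions, available by Slater's condition, are (C1) with distance \<open>0\<close>.
\<close>

section \<open>Right-hand derivatives of concave functions\<close>

lemma right_deriv_eq:
  assumes "(f has_real_derivative D) (at_right t)"
  shows "right_deriv f t = D"
  unfolding right_deriv_def
proof (rule the_equality[where P = "\<lambda>D. (f has_real_derivative D) (at_right t)", OF assms])
  fix E assume "(f has_real_derivative E) (at_right t)"
  with assms show "E = D"
    unfolding has_field_derivative_iff
    using tendsto_unique trivial_limit_at_right_real by blast
qed

lemma right_deriv_eq_deriv:
  assumes "f differentiable (at t)"
  shows "has_right_deriv f t" "right_deriv f t = deriv f t"
proof -
  have "(f has_real_derivative deriv f t) (at_right t)"
    using assms DERIV_deriv_iff_real_differentiable has_field_derivative_at_within by blast
  then show "has_right_deriv f t" "right_deriv f t = deriv f t"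
    by (auto simp: has_right_deriv_def right_deriv_eq)
qed

lemma continuous_on_halfline_tendsto_0:
  fixes f :: "real \<Rightarrow> real"
  assumes "continuous_on {0..} f"
  shows "(f \<longlongrightarrow> f 0) (at_right 0)"
proof -
  have "(f \<longlongrightarrow> f 0) (at 0 within {0..})"
    using assms by (simp add: continuous_on)
  then show ?thesis
    by (rule tendsto_within_subset) auto
qed

text \<open>L'Hopital's rule for \<open>(f x - f 0) / x\<close>: the limit of the derivative at 0 is
  the right-hand derivative there. Through it the limits required by (A1) and (A2) yield derivatives
  at 0.\<close>

lemma right_deriv_0:
  assumes cont: "continuous_on {0..} f"
    and diff: "\<And>t. 0 < t \<Longrightarrow> f differentiable (at t)"
    and lim: "(deriv f \<longlongrightarrow> L) (at_right 0)"
  shows "has_right_deriv f 0" "right_deriv f 0 = L"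
proof -
  have f0: "((\<lambda>x. f x - f 0) \<longlongrightarrow> 0) (at_right 0)"
    using tendsto_diff[OF continuous_on_halfline_tendsto_0[OF cont] tendsto_const[of "f 0"]] by simp
  have pos: "eventually (\<lambda>x::real. 0 < x) (at_right 0)"
    by (simp add: eventually_at_right_less)
  have "((\<lambda>x. (f x - f 0) / x) \<longlongrightarrow> L) (at_right 0)"
  proof (rule lhopital_right_0[where g' = "\<lambda>_. 1" and f' = "deriv f"])
    show "eventually (\<lambda>x. DERIV (\<lambda>x. f x - f 0) x :> deriv f x) (at_right 0)"
      using pos
    proof eventually_elim
      case (elim x)
      have "DERIV f x :> deriv f x"
        using diff[OF elim] DERIV_deriv_iff_real_differentiable by blast
      from DERIV_diff[OF this DERIV_const[of "f 0"]] show ?case by simp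
    qed
    show "eventually (\<lambda>x::real. x \<noteq> 0) (at_right 0)"
      using pos by eventually_elim simp
  qed (use f0 lim in \<open>auto intro: tendsto_eq_intros\<close>)
  then have "(f has_real_derivative L) (at_right 0)"
    by (simp add: has_field_derivative_iff)
  then show "has_right_deriv f 0" "right_deriv f 0 = L"
    by (auto simp: has_right_deriv_def right_deriv_eq)
qed

lemma concave_on_supergradient:
  assumes conc: "concave_on {0..} f" and cont: "continuous_on {0..} f"
    and diff: "\<And>t. 0 < t \<Longrightarrow> f differentiable (at t)"
    and lim: "(deriv f \<longlongrightarrow> L) (at_right 0)"
    and t: "0 \<le> t" and s: "0 \<le> s"
  shows "f s \<le> f t + right_deriv f t * (s - t)"
proof -
  have pos: "f s \<le> f r + deriv f r * (s - r)" if r: "0 < r" for r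
  proof -
    have "(f has_real_derivative deriv f r) (at r)"
      using diff[OF r] DERIV_deriv_iff_real_differentiable by blast
    then have "((\<lambda>x. - f x) has_real_derivative - deriv f r) (at r within {0..})"
      by (rule DERIV_minus[OF has_field_derivative_at_within])
    from convex_on_imp_above_tangent[OF conc[unfolded concave_on_def] _ _ _ this]
    have "- f s - (- f r) \<ge> - deriv f r * (s - r)"
      using r s by auto
    then show ?thesis by (simp add: algebra_simps)
  qed
  show ?thesis
  proof (cases "t = 0")
    case False
    then show ?thesis
      using pos[of t] t diff right_deriv_eq_deriv(2)[of f t] by auto
  next
    case True
    have "((\<lambda>r. f r + deriv f r * (s - r)) \<longlongrightarrow> f 0 + L * (s - 0)) (at_right 0)"
      by (intro tendsto_intros lim continuous_on_halfline_tendsto_0[OF cont])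
    moreover have "eventually (\<lambda>r. f s \<le> f r + deriv f r * (s - r)) (at_right 0)"
      using eventually_at_right_less[of 0] by eventually_elim (rule pos)
    ultimately have "f s \<le> f 0 + L * (s - 0)"
      using tendsto_lowerbound trivial_limit_at_right_real by blast
    with True show ?thesis
      using right_deriv_0(2)[OF cont diff lim] by simp
  qed
qed

text \<open>Supplies the strictly positive weights \<open>ir_w\<close>; at t = 0 positivity comes
  from \<open>0 < L\<close>.\<close>

lemma assumption_A1_right_deriv:
  assumes "assumption_A1 \<psi>" "0 \<le> t"
  shows "has_right_deriv \<psi> t" "0 < right_deriv \<psi> t"
proof -
  from assms obtain L where L: "0 < L" "(deriv \<psi> \<longlongrightarrow> L) (at_right 0)"
    and a: "continuous_on {0..} \<psi>" "\<And>t. 0 < t \<Longrightarrow> \<psi> differentiable (at t)"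
      "\<And>t. 0 < t \<Longrightarrow> 0 < deriv \<psi> t"
    unfolding assumption_A1_def by blast
  have "has_right_deriv \<psi> t \<and> 0 < right_deriv \<psi> t"
  proof (cases "t = 0")
    case True
    then show ?thesis using right_deriv_0[OF a(1,2) L(2)] L(1) by simp
  next
    case False
    with assms(2) have "0 < t" by simp
    then show ?thesis using right_deriv_eq_deriv[OF a(2)] a(3) by simp
  qed
  then show "has_right_deriv \<psi> t" "0 < right_deriv \<psi> t" by auto
qed

text \<open>Nonnegativity legitimizes the square root in \<open>ir_v\<close>; the last claim is the
  tangent majorization of \<phi>.\<close>

lemma assumption_A2_right_deriv:
  assumes "assumption_A2 \<phi>" "0 \<le> t"
  shows "has_right_deriv \<phi> t" "0 \<le> right_deriv \<phi> t"
    and "\<And>s. 0 \<le> s \<Longrightarrow> \<phi> s \<le> \<phi> t + right_deriv \<phi> t * (s - t)"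
proof -
  from assms obtain L where L: "0 < L" "(deriv \<phi> \<longlongrightarrow> L) (at_right 0)"
    and a: "continuous_on {0..} \<phi>" "\<And>t. 0 < t \<Longrightarrow> \<phi> differentiable (at t)"
      "\<And>t. 0 < t \<Longrightarrow> 0 \<le> deriv \<phi> t" "concave_on {0..} \<phi>"
    unfolding assumption_A2_def by blast
  have "has_right_deriv \<phi> t \<and> 0 \<le> right_deriv \<phi> t"
  proof (cases "t = 0")
    case True
    then show ?thesis using right_deriv_0[OF a(1,2) L(2)] L(1) by simp
  next
    case False
    with assms(2) have "0 < t" by simp
    then show ?thesis using right_deriv_eq_deriv[OF a(2)] a(3) by simp
  qed
  then show "has_right_deriv \<phi> t" "0 \<le> right_deriv \<phi> t" by auto
  show "\<phi> s \<le> \<phi> t + right_deriv \<phi> t * (s - t)" if "0 \<le> s" for s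
    using concave_on_supergradient[OF a(4,1,2) L(2) assms(2) that] .
qed

section \<open>The pseudoinverse of a matrix of full row rank\<close>

text \<open>X A and Y A are symmetric, so transposing X A = (X A)(Y A) gives X A = (Y A)(X A) = Y A.
  Likewise A Y = A X, whence X = X A X = Y A X = Y A Y = Y.\<close>

lemma is_moore_penrose_unique:
  fixes A :: "real ^ 'n ^ 'm"
  assumes X: "is_moore_penrose A X" and Y: "is_moore_penrose A Y"
  shows "X = Y"
proof -
  have X': "A ** X ** A = A" "X ** A ** X = X" "transpose (A ** X) = A ** X" "transpose (X ** A) = X ** A"
    and Y': "A ** Y ** A = A" "Y ** A ** Y = Y" "transpose (A ** Y) = A ** Y" "transpose (Y ** A) = Y ** A"
    using X Y by (auto simp: is_moore_penrose_def)
  have "transpose (X ** A) = transpose ((X ** A) ** (Y ** A))"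
    using Y'(1) by (simp flip: matrix_mul_assoc)
  then have "X ** A = (Y ** A) ** (X ** A)"
    by (simp only: matrix_transpose_mul[of "X ** A"] X'(4) Y'(4))
  then have XA: "X ** A = Y ** A"
    using X'(1) by (simp flip: matrix_mul_assoc)
  have "transpose (A ** Y) = transpose ((A ** X) ** (A ** Y))"
    using X'(1) by (simp add: matrix_mul_assoc)
  then have "A ** Y = (A ** Y) ** (A ** X)"
    by (simp only: matrix_transpose_mul[of "A ** X"] X'(3) Y'(3))
  then have AX: "A ** Y = A ** X"
    using Y'(1) by (simp add: matrix_mul_assoc)
  have "X = Y ** A ** X" using X'(2) XA by simp
  also have "\<dots> = Y" using Y'(2) AX by (simp flip: matrix_mul_assoc)
  finally show ?thesis .
qed

text \<open>If A B = I, then A X = A X (A B) = (A X A) B = A B = I.\<close>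

lemma full_row_rank_moore_penrose_right_inverse:
  fixes A :: "real ^ 'n ^ 'm"
  assumes "rank A = CARD('m)" "is_moore_penrose A X"
  shows "A ** X = mat 1"
proof -
  obtain B where B: "A ** B = mat 1"
    using assms(1) full_rank_surjective[of A] matrix_right_invertible_surjective[of A] by auto
  have "A ** X = A ** X ** (A ** B)"
    by (simp add: B)
  also have "\<dots> = A ** B"
    using assms(2) by (metis is_moore_penrose_def matrix_mul_assoc)
  finally show ?thesis using B by simp
qed

text \<open>The square of the norm of A^T x equals the inner product of x with A A^T x, and A^T is
  injective, so the kernel of A A^T is trivial.\<close>

lemma full_row_rank_gram_invertible:
  fixes A :: "real ^ 'n ^ 'm"
  assumes "rank A = CARD('m)"
  shows "invertible (A ** transpose A)"
proof -
  have inj: "inj ((*v) (transpose A))"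
    using assms full_rank_injective[of "transpose A"] by (simp add: rank_transpose)
  have "x = 0" if "(A ** transpose A) *v x = 0" for x
  proof -
    have "(transpose A *v x) \<bullet> (transpose A *v x) = x \<bullet> (A *v (transpose A *v x))"
      by (metis dot_lmul_matrix vector_transpose_matrix transpose_transpose transpose_matrix_vector)
    also have "\<dots> = 0"
      using that by (metis inner_zero_right matrix_vector_mul_assoc)
    finally have "transpose A *v x = transpose A *v 0" by simp
    then show ?thesis by (rule injD[OF inj])
  qed
  then show ?thesis
    using matrix_left_invertible_ker invertible_left_inverse by blast
qed

text \<open>The witness is A^T (A A^T)^(-1). The inverse \<open>H\<close> is symmetric because its
  transpose is a left inverse of the same symmetric matrix.\<close>

lemma full_row_rank_ex_moore_penrose:
  fixes A :: "real ^ 'n ^ 'm"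
  assumes "rank A = CARD('m)"
  shows "\<exists>X. is_moore_penrose A X"
proof -
  let ?G = "A ** transpose A"
  obtain H where GH: "?G ** H = mat 1" "H ** ?G = mat 1"
    using full_row_rank_gram_invertible[OF assms] unfolding invertible_def by blast
  have "transpose H ** ?G = transpose (?G ** H)"
    by (simp add: matrix_transpose_mul matrix_mul_assoc)
  then have "transpose H ** ?G = mat 1" using GH by simp
  then have symH: "transpose H = H"
    by (metis GH(1) matrix_mul_assoc matrix_mul_lid matrix_mul_rid)
  have AX: "A ** (transpose A ** H) = mat 1"
    using GH by (simp add: matrix_mul_assoc)
  have "is_moore_penrose A (transpose A ** H)"
    unfolding is_moore_penrose_def AX
    using AX by (simp add: matrix_transpose_mul symH flip: matrix_mul_assoc)
  then show ?thesis ..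
qed

lemma full_row_rank_pinv:
  fixes A :: "real ^ 'n ^ 'm"
  assumes "rank A = CARD('m)"
  shows "A ** pinv A = mat 1"
proof -
  have "\<exists>!X. is_moore_penrose A X"
    using full_row_rank_ex_moore_penrose[OF assms] is_moore_penrose_unique by metis
  then have "is_moore_penrose A (pinv A)"
    unfolding pinv_def by (rule theI')
  then show ?thesis
    by (rule full_row_rank_moore_penrose_right_inverse[OF assms])
qed

section \<open>Optimality conditions for the subproblem\<close>

text \<open>Lagrange duality with one constraint: a hyperplane separates the attainable pairs of
  objective and constraint values from those that would beat m. Slater's point makes it
  non-vertical, and its slope is the multiplier.\<close>

lemma slater_multiplier:
  fixes f g :: "'a::real_vector \<Rightarrow> real"
  assumes f: "convex_on UNIV f" and g: "convex_on UNIV g"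
    and slater: "g z0 < 0" and opt: "\<And>z. g z \<le> 0 \<Longrightarrow> m \<le> f z"
  obtains l where "0 \<le> l" "\<And>z. m \<le> f z + l * g z"
proof -
  \<comment> \<open>\<open>S\<close> is closed upwards in both coordinates, which makes it convex. A
    point of \<open>S\<close> in \<open>T\<close> would come from a feasible z with f z < m.\<close>
  define S where "S = {(r, c). \<exists>z. f z \<le> r \<and> g z \<le> (c::real)}"
  define T where "T = {(r, c). r < m \<and> c \<le> (0::real)}"
  have "convex S"
  proof (rule convexI)
    fix p q u v assume pq: "p \<in> S" "q \<in> S" and uv: "0 \<le> u" "0 \<le> v" "u + v = (1::real)"
    obtain x y where "f x \<le> fst p" "g x \<le> snd p" "f y \<le> fst q" "g y \<le> snd q"
      using pq by (auto simp: S_def)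
    then have "u * f x + v * f y \<le> u * fst p + v * fst q" "u * g x + v * g y \<le> u * snd p + v * snd q"
      using uv by (auto intro!: add_mono mult_left_mono)
    moreover have "f (u *\<^sub>R x + v *\<^sub>R y) \<le> u * f x + v * f y" "g (u *\<^sub>R x + v *\<^sub>R y) \<le> u * g x + v * g y"
      using f g uv unfolding convex_on_def by auto
    ultimately show "u *\<^sub>R p + v *\<^sub>R q \<in> S"
      unfolding S_def by (auto simp: case_prod_beta intro!: exI[of _ "u *\<^sub>R x + v *\<^sub>R y"])
  qed
  moreover have "convex T"
  proof -
    have "T = {..<m} \<times> {..0}" by (auto simp: T_def)
    then show ?thesis by (auto intro: convex_Times)
  qed
  moreover have "S \<noteq> {}" "T \<noteq> {}" "S \<inter> T = {}"
  proof -
    have "(f z0, g z0) \<in> S" by (auto simp: S_def)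
    then show "S \<noteq> {}" by blast
    have "(m - 1, 0) \<in> T" by (auto simp: T_def)
    then show "T \<noteq> {}" by blast
    show "S \<inter> T = {}"
    proof (rule equals0I)
      fix p assume "p \<in> S \<inter> T"
      then obtain z where "f z \<le> fst p" "g z \<le> snd p" "fst p < m" "snd p \<le> 0"
        by (auto simp: S_def T_def)
      with opt[of z] show False by linarith
    qed
  qed
  ultimately obtain a k where a: "a \<noteq> 0" and aS: "\<forall>p\<in>S. a \<bullet> p \<le> k" and aT: "\<forall>p\<in>T. k \<le> a \<bullet> p"
    using separating_hyperplane_sets by metis
  obtain \<alpha> \<beta> where ab: "a = (- \<alpha>, - \<beta>)"
    by (metis minus_minus prod.exhaust_sel)
  have ge: "\<alpha> * r' + \<beta> * c' \<le> \<alpha> * r + \<beta> * c" if "f z \<le> r" "g z \<le> c" "r' < m" "c' \<le> 0" for z r c r' c'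
  proof -
    have "(r, c) \<in> S" "(r', c') \<in> T" using that by (auto simp: S_def T_def)
    with aS aT have "a \<bullet> (r, c) \<le> a \<bullet> (r', c')" by fastforce
    then show ?thesis by (simp add: ab)
  qed
  have \<alpha>: "0 \<le> \<alpha>"
  proof -
    have "\<alpha> * (min m (f z0) - 1) + \<beta> * g z0 \<le> \<alpha> * f z0 + \<beta> * g z0"
      by (rule ge[of z0]) (use slater in auto)
    then have "0 \<le> \<alpha> * (f z0 - (min m (f z0) - 1))" by (simp add: algebra_simps)
    moreover have "0 < f z0 - (min m (f z0) - 1)" by simp
    ultimately show ?thesis by (simp add: zero_le_mult_iff)
  qed
  \<comment> \<open>The second coordinate of a point of \<open>S\<close> can be increased without
    bound, so a negative \<beta> would violate the separation; the value of c below makes \<beta> c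
    equal to \<open>- (\<bar>d\<bar> + 1)\<close>, which is less than d.\<close>
  have \<beta>: "0 \<le> \<beta>"
  proof -
    have "\<alpha> * (m - 1) + \<beta> * 0 \<le> \<alpha> * max (f z0) (m - 1) + \<beta> * c" if "0 \<le> c" for c
      by (rule ge[of z0]) (use slater that in auto)
    then have le: "\<alpha> * (m - 1) - \<alpha> * max (f z0) (m - 1) \<le> \<beta> * c" if "0 \<le> c" for c
      using that by fastforce
    define d where "d = \<alpha> * (m - 1) - \<alpha> * max (f z0) (m - 1)"
    show ?thesis
    proof (rule ccontr)
      assume "\<not> 0 \<le> \<beta>"
      then have "d \<le> \<beta> * ((\<bar>d\<bar> + 1) / - \<beta>)"
        using le[of "(\<bar>d\<bar> + 1) / - \<beta>"] by (simp add: d_def divide_nonneg_neg)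
      moreover have "\<beta> * ((\<bar>d\<bar> + 1) / - \<beta>) = - (\<bar>d\<bar> + 1)"
        using \<open>\<not> 0 \<le> \<beta>\<close> by simp
      ultimately show False by linarith
    qed
  qed
  \<comment> \<open>\<open>T\<close> demands r < m strictly, so m itself is reached only as a limit
    from the left.\<close>
  have key: "\<alpha> * m \<le> \<alpha> * f z + \<beta> * g z" for z
  proof -
    have "((\<lambda>r. \<alpha> * r + \<beta> * 0) \<longlongrightarrow> \<alpha> * m + \<beta> * 0) (at_left m)"
      by (intro tendsto_intros)
    moreover have "eventually (\<lambda>r. \<alpha> * r + \<beta> * 0 \<le> \<alpha> * f z + \<beta> * g z) (at_left m)"
      using ge[of z "f z" "g z" _ 0] by (auto intro!: eventually_at_leftI[of "m - 1"])
    ultimately have "\<alpha> * m + \<beta> * 0 \<le> \<alpha> * f z + \<beta> * g z"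
      using tendsto_upperbound trivial_limit_at_left_real by blast
    then show ?thesis by simp
  qed
  \<comment> \<open>With \<alpha> = 0, \<open>key\<close> at the Slater point forces \<beta> = 0 as
    well, and the normal vector would vanish.\<close>
  have "\<alpha> \<noteq> 0"
  proof
    assume "\<alpha> = 0"
    with key[of z0] have "0 \<le> \<beta> * g z0" by simp
    with slater \<beta> have "\<beta> = 0" by (simp add: zero_le_mult_iff)
    with \<open>\<alpha> = 0\<close> a ab show False by (simp add: zero_prod_def)
  qed
  with \<alpha> have "0 < \<alpha>" by simp
  show ?thesis
  proof (rule that[of "\<beta> / \<alpha>"])
    show "0 \<le> \<beta> / \<alpha>" using \<alpha> \<beta> by simp
    show "m \<le> f z + \<beta> / \<alpha> * g z" for z
      using key[of z] \<open>0 < \<alpha>\<close> by (simp add: field_simps)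
  qed
qed

text \<open>The convexity gap is exactly t (1 - t) times the squared distance of x and y.\<close>

lemma power2_norm_convex_on:
  "convex_on UNIV (\<lambda>x::'a::real_inner. (norm x)\<^sup>2)"
proof (rule convex_onI)
  fix t :: real and x y :: 'a assume t: "0 < t" "t < 1"
  have "(1 - t) * (norm x)\<^sup>2 + t * (norm y)\<^sup>2 - (norm ((1 - t) *\<^sub>R x + t *\<^sub>R y))\<^sup>2
      = t * (1 - t) * (norm (x - y))\<^sup>2"
    by (simp add: power2_norm_eq_inner inner_commute algebra_simps)
  also have "\<dots> \<ge> 0" using t by simp
  finally show "(norm ((1 - t) *\<^sub>R x + t *\<^sub>R y))\<^sup>2 \<le> (1 - t) * (norm x)\<^sup>2 + t * (norm y)\<^sup>2"
    by simp
qed simp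

section \<open>The weighted l1 norm: convexity and subgradients\<close>

lemma convex_on_l1_norm_mult:
  fixes w :: "real ^ 'n"
  shows "convex_on UNIV (\<lambda>z. l1_norm (w * z))"
proof (rule convex_onI)
  fix t :: real and x y :: "real ^ 'n" assume t: "0 < t" "t < 1"
  have "l1_norm (w * ((1 - t) *\<^sub>R x + t *\<^sub>R y)) \<le>
      (\<Sum>i\<in>UNIV. (1 - t) * \<bar>w $ i * x $ i\<bar> + t * \<bar>w $ i * y $ i\<bar>)"
    unfolding l1_norm_def
  proof (rule sum_mono)
    fix i
    have "(w * ((1 - t) *\<^sub>R x + t *\<^sub>R y)) $ i = (1 - t) * (w $ i * x $ i) + t * (w $ i * y $ i)"
      by (simp add: algebra_simps)
    then show "\<bar>(w * ((1 - t) *\<^sub>R x + t *\<^sub>R y)) $ i\<bar> \<le> (1 - t) * \<bar>w $ i * x $ i\<bar> + t * \<bar>w $ i * y $ i\<bar>"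
      using abs_triangle_ineq[of "(1 - t) * (w $ i * x $ i)" "t * (w $ i * y $ i)"] t
      by (simp add: abs_mult)
  qed
  also have "\<dots> = (1 - t) * l1_norm (w * x) + t * l1_norm (w * y)"
    by (simp add: l1_norm_def sum.distrib sum_distrib_left)
  finally show "l1_norm (w * ((1 - t) *\<^sub>R x + t *\<^sub>R y)) \<le> (1 - t) * l1_norm (w * x) + t * l1_norm (w * y)" .
qed simp

text \<open>Dividing p by the weights gives s. The sum is separable, so the subgradient inequality
  can be tested one coordinate at a time and reassembled. This yields the form \<open>w * s\<close>
  that (C1) asks for.\<close>

lemma subdifferential_l1_norm_mult:
  fixes w :: "real ^ 'n"
  assumes w: "\<And>i. 0 < w $ i" and p: "p \<in> subdifferential (\<lambda>z. l1_norm (w * z)) x"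
  shows "\<exists>s \<in> subdifferential l1_norm x. w * s = p"
proof
  define s where "s = (\<chi> i. p $ i / w $ i)"
  have wi: "w $ i \<noteq> 0" for i using w[of i] by simp
  show "w * s = p" using wi by (simp add: s_def vec_eq_iff)
  have coord: "\<bar>x $ i\<bar> + s $ i * (y $ i - x $ i) \<le> \<bar>y $ i\<bar>" for y i
  proof -
    \<comment> \<open>z agrees with y in coordinate i and with x elsewhere, so all other summands
      cancel.\<close>
    define z where "z = x + axis i (y $ i - x $ i)"
    have zi: "z $ i = y $ i" and zj: "j \<noteq> i \<Longrightarrow> z $ j = x $ j" for j
      by (auto simp: z_def axis_def)
    have l1: "l1_norm (w * u) = \<bar>w $ i * u $ i\<bar> + (\<Sum>j\<in>UNIV - {i}. \<bar>w $ j * u $ j\<bar>)" for u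
      unfolding l1_norm_def by (simp add: sum.remove[of UNIV i])
    have eq: "(\<Sum>j\<in>UNIV - {i}. \<bar>w $ j * z $ j\<bar>) = (\<Sum>j\<in>UNIV - {i}. \<bar>w $ j * x $ j\<bar>)"
      by (rule sum.cong) (auto simp: zj)
    have "l1_norm (w * x) + p \<bullet> (z - x) \<le> l1_norm (w * z)"
      using p by (simp add: subdifferential_def)
    moreover have "p \<bullet> (z - x) = p $ i * (y $ i - x $ i)"
      by (simp add: z_def inner_axis)
    ultimately have "w $ i * \<bar>x $ i\<bar> + p $ i * (y $ i - x $ i) \<le> w $ i * \<bar>y $ i\<bar>"
      unfolding l1 eq zi using w[of i] by (simp add: abs_mult)
    moreover have "p $ i = w $ i * s $ i" using wi[of i] by (simp add: s_def)
    ultimately have "w $ i * (\<bar>x $ i\<bar> + s $ i * (y $ i - x $ i)) \<le> w $ i * \<bar>y $ i\<bar>"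
      by (simp add: distrib_left mult.assoc)
    then show ?thesis using w[of i] by simp
  qed
  show "s \<in> subdifferential l1_norm x"
    unfolding subdifferential_def l1_norm_def inner_vec_def
    using coord by (auto simp flip: sum.distrib intro!: sum_mono)
qed

section \<open>Existence of a solution of the subproblem\<close>

lemma continuous_on_l1_norm_mult: "continuous_on S (\<lambda>z. l1_norm (w * z))"
  unfolding l1_norm_def vector_mult_component by (intro continuous_intros)

lemma continuous_on_residual:
  fixes M :: "real ^ 'n ^ 'm"
  shows "continuous_on S (\<lambda>z. (norm (M *v z - c))\<^sup>2)"
  by (intro continuous_intros matrix_vector_mult_linear_continuous_on)

text \<open>Positive weights bound every coordinate on the sublevel set of the objective at x, so
  its intersection with the constraint set is compact; feasible points outside it are worse than
  x.\<close>

lemma weighted_l1_minimizer: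
  fixes M :: "real ^ 'n ^ 'm"
  assumes w: "\<And>i. 0 < w $ i" and x: "(norm (M *v x - c))\<^sup>2 \<le> s"
  obtains z where "(norm (M *v z - c))\<^sup>2 \<le> s"
    "\<And>y. (norm (M *v y - c))\<^sup>2 \<le> s \<Longrightarrow> l1_norm (w * z) \<le> l1_norm (w * y)"
proof -
  define K where "K = {z. (norm (M *v z - c))\<^sup>2 \<le> s} \<inter> {z. l1_norm (w * z) \<le> l1_norm (w * x)}"
  have "closed K"
    unfolding K_def
    by (intro closed_Int closed_Collect_le continuous_on_l1_norm_mult continuous_on_residual continuous_on_const)
  moreover have "bounded K"
    unfolding bounded_iff
  proof (intro exI ballI)
    fix z assume "z \<in> K"
    have "\<bar>z $ i\<bar> \<le> l1_norm (w * x) / w $ i" for i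
    proof -
      have "\<bar>(w * z) $ i\<bar> \<le> l1_norm (w * z)"
        unfolding l1_norm_def by (rule member_le_sum) auto
      also have "\<dots> \<le> l1_norm (w * x)" using \<open>z \<in> K\<close> by (simp add: K_def)
      finally show ?thesis using w[of i] by (simp add: abs_mult field_simps)
    qed
    then have "(\<Sum>i\<in>UNIV. \<bar>z $ i\<bar>) \<le> (\<Sum>i\<in>UNIV. l1_norm (w * x) / w $ i)"
      by (intro sum_mono)
    then show "norm z \<le> (\<Sum>i\<in>UNIV. l1_norm (w * x) / w $ i)"
      using norm_le_l1_cart[of z] by linarith
  qed
  ultimately have "compact K" by (simp add: compact_eq_bounded_closed)
  moreover have "x \<in> K" using x by (simp add: K_def)
  ultimately obtain z where z: "z \<in> K" "\<And>y. y \<in> K \<Longrightarrow> l1_norm (w * z) \<le> l1_norm (w * y)"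
    using continuous_attains_inf[OF _ _ continuous_on_l1_norm_mult, of K w] by blast
  show ?thesis
  proof (rule that)
    show "(norm (M *v z - c))\<^sup>2 \<le> s" using z(1) by (simp add: K_def)
    show "l1_norm (w * z) \<le> l1_norm (w * y)" if "(norm (M *v y - c))\<^sup>2 \<le> s" for y
    proof (cases "y \<in> K")
      case False
      with that have "l1_norm (w * x) \<le> l1_norm (w * y)" by (simp add: K_def)
      with z(2)[OF \<open>x \<in> K\<close>] show ?thesis by linarith
    qed (rule z(2))
  qed
qed

section \<open>First-order conditions: penalized minimizers, normal cone and KKT\<close>

lemma convex_on_residual:
  fixes M :: "real ^ 'n ^ 'm"
  shows "convex_on UNIV (\<lambda>z. (norm (M *v z - c))\<^sup>2 - s)"
proof (rule convex_onI)
  fix t :: real and x y :: "real ^ 'n" assume t: "0 < t" "t < 1"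
  have "M *v ((1 - t) *\<^sub>R x + t *\<^sub>R y) - c = (1 - t) *\<^sub>R (M *v x - c) + t *\<^sub>R (M *v y - c)"
    by (simp add: algebra_simps)
  then show "(norm (M *v ((1 - t) *\<^sub>R x + t *\<^sub>R y) - c))\<^sup>2 - s
      \<le> (1 - t) * ((norm (M *v x - c))\<^sup>2 - s) + t * ((norm (M *v y - c))\<^sup>2 - s)"
    using convex_onD[OF power2_norm_convex_on, of t "M *v x - c" "M *v y - c"] t
    by (simp add: algebra_simps)
qed simp

text \<open>Fermat's rule for f plus a smooth penalty: minus the gradient of the penalty is a
  subgradient of f. It follows by moving from z towards y by a step t, dividing by t and letting t
  tend to 0.\<close>

lemma penalty_minimizer_subgradient:
  fixes M :: "real ^ 'n ^ 'm"
  assumes f: "convex_on UNIV f"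
    and min: "\<And>y. f z + l * (norm (M *v z - c))\<^sup>2 \<le> f y + l * (norm (M *v y - c))\<^sup>2"
  shows "- (transpose M *v ((2 * l) *\<^sub>R (M *v z - c))) \<in> subdifferential f z"
  unfolding subdifferential_def
proof (intro CollectI allI)
  fix y
  define u where "u = M *v z - c"
  define d where "d = M *v (y - z)"
  \<comment> \<open>\<open>D\<close> collects the first-order terms of the estimate along the
    segment from z to y; the remainder is quadratic in t.\<close>
  define D where "D = f y - f z + 2 * l * (u \<bullet> d)"
  have pos: "0 \<le> D + l * (d \<bullet> d) * t" if t: "0 < t" "t \<le> 1" for t
  proof -
    let ?x = "(1 - t) *\<^sub>R z + t *\<^sub>R y"
    have "M *v ?x - c = u + t *\<^sub>R d"
      by (simp add: u_def d_def algebra_simps)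
    then have "(norm (M *v ?x - c))\<^sup>2 = (norm u)\<^sup>2 + 2 * t * (u \<bullet> d) + t * t * (d \<bullet> d)"
      by (simp only: power2_norm_eq_inner) (simp add: inner_commute algebra_simps)
    moreover have "f ?x \<le> (1 - t) * f z + t * f y"
      using convex_onD[OF f] t by simp
    ultimately have "f z + l * (norm u)\<^sup>2 \<le> (1 - t) * f z + t * f y
        + l * ((norm u)\<^sup>2 + 2 * t * (u \<bullet> d) + t * t * (d \<bullet> d))"
      using min[of ?x] by (simp add: u_def)
    then have "0 \<le> t * (D + l * (d \<bullet> d) * t)"
      by (simp add: D_def algebra_simps)
    with t show ?thesis by (simp add: zero_le_mult_iff)
  qed
  have "((\<lambda>t. D + l * (d \<bullet> d) * t) \<longlongrightarrow> D + l * (d \<bullet> d) * 0) (at_right 0)"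
    by (intro tendsto_intros)
  moreover have "eventually (\<lambda>t. 0 \<le> D + l * (d \<bullet> d) * t) (at_right 0)"
    using pos by (auto intro!: eventually_at_rightI[of 0 1])
  ultimately have "0 \<le> D"
    using tendsto_lowerbound[where F = "at_right (0::real)"] by fastforce
  moreover have "(transpose M *v ((2 * l) *\<^sub>R u)) \<bullet> (y - z) = 2 * l * (u \<bullet> d)"
    by (simp add: d_def dot_lmul_matrix)
  ultimately show "f z + - (transpose M *v ((2 * l) *\<^sub>R (M *v z - c))) \<bullet> (y - z) \<le> f y"
    by (simp add: D_def u_def)
qed

text \<open>If l is nonzero, complementarity puts u on the sphere, where Cauchy-Schwarz shows that u
  is an outward normal.\<close>

lemma scaleR_in_normal_cone_ball:
  fixes u :: "'a::real_inner"
  assumes "(norm u)\<^sup>2 \<le> s" "0 \<le> l" "l * ((norm u)\<^sup>2 - s) = 0"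
  shows "l *\<^sub>R u \<in> normal_cone {z. (norm z)\<^sup>2 \<le> s} u"
proof (cases "l = 0")
  case False
  with assms have u: "(norm u)\<^sup>2 = s" by simp
  have le: "u \<bullet> z \<le> u \<bullet> u" if "(norm z)\<^sup>2 \<le> s" for z
  proof -
    have "norm z \<le> norm u" using that u by (simp add: power2_le_imp_le)
    then have "norm u * norm z \<le> norm u * norm u" by (simp add: mult_left_mono)
    with norm_cauchy_schwarz[of u z] show ?thesis
      by (simp add: power2_eq_square flip: power2_norm_eq_inner)
  qed
  then show ?thesis
    using assms mult_left_mono[OF le \<open>0 \<le> l\<close>]
    by (auto simp: normal_cone_def inner_diff_right right_diff_distrib)
qed (use assms in \<open>simp add: normal_cone_def\<close>)

lemma weighted_l1_kkt:
  fixes M :: "real ^ 'n ^ 'm"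
  assumes w: "\<And>i. 0 < w $ i" and slater: "(norm (M *v z0 - c))\<^sup>2 < s"
    and z: "(norm (M *v z - c))\<^sup>2 \<le> s"
    and opt: "\<And>y. (norm (M *v y - c))\<^sup>2 \<le> s \<Longrightarrow> l1_norm (w * z) \<le> l1_norm (w * y)"
  obtains \<xi> \<nu> where "\<xi> \<in> subdifferential l1_norm z"
    "\<nu> \<in> normal_cone {v. (norm v)\<^sup>2 \<le> s} (M *v z - c)" "w * \<xi> + transpose M *v \<nu> = 0"
proof -
  let ?u = "M *v z - c"
  obtain l where l: "0 \<le> l"
    and lagr: "\<And>y. l1_norm (w * z) \<le> l1_norm (w * y) + l * ((norm (M *v y - c))\<^sup>2 - s)"
  proof (rule slater_multiplier[OF convex_on_l1_norm_mult[of w] convex_on_residual[of M c s]])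
    show "(norm (M *v z0 - c))\<^sup>2 - s < 0" using slater by simp
    show "l1_norm (w * z) \<le> l1_norm (w * y)" if "(norm (M *v y - c))\<^sup>2 - s \<le> 0" for y
      using opt that by simp
  qed blast
  \<comment> \<open>Complementary slackness: \<open>lagr\<close> at z itself bounds the product
    below by 0, feasibility of z bounds it above by 0.\<close>
  have compl: "l * ((norm ?u)\<^sup>2 - s) = 0"
    using lagr[of z] mult_nonneg_nonpos[OF l, of "(norm ?u)\<^sup>2 - s"] z by simp
  \<comment> \<open>By \<open>compl\<close>, z minimizes the penalized objective; the factor 2 comes
    from the gradient of the squared norm.\<close>
  have "- (transpose M *v ((2 * l) *\<^sub>R ?u)) \<in> subdifferential (\<lambda>z. l1_norm (w * z)) z"
  proof (rule penalty_minimizer_subgradient[OF convex_on_l1_norm_mult])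
    show "l1_norm (w * z) + l * (norm ?u)\<^sup>2 \<le> l1_norm (w * y) + l * (norm (M *v y - c))\<^sup>2" for y
      using lagr[of y] compl by (simp only: right_diff_distrib)
  qed
  then obtain \<xi> where "\<xi> \<in> subdifferential l1_norm z" "w * \<xi> = - (transpose M *v ((2 * l) *\<^sub>R ?u))"
    using subdifferential_l1_norm_mult[OF w] by blast
  moreover have "(2 * l) *\<^sub>R ?u \<in> normal_cone {v. (norm v)\<^sup>2 \<le> s} ?u"
    using scaleR_in_normal_cone_ball[OF z, of "2 * l"] l compl by auto
  ultimately show ?thesis
    by (intro that[of \<xi> "(2 * l) *\<^sub>R ?u"]) auto
qed

section \<open>The iteration\<close>

lemma diag_mat_mult_vec: "diag_mat v *v y = v * y"
  by (simp add: diag_mat_def matrix_vector_mult_def vec_eq_iff if_distrib[where f = "\<lambda>a. a * _"] cong: if_cong)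

lemma ir_residual:
  "ir_A \<phi> A b x *v z - ir_b \<phi> A b x = ir_v \<phi> A b x * (A *v z - b)"
  by (simp add: ir_A_def ir_b_def diag_mat_mult_vec right_diff_distrib flip: matrix_vector_mul_assoc)

text \<open>Squaring undoes the square root in \<open>ir_v\<close>. The constraint becomes linear in
  the squared residuals, the form in which the tangent majorization of \<phi> applies.\<close>

lemma power2_norm_ir_residual:
  assumes "assumption_A2 \<phi>"
  shows "(norm (ir_A \<phi> A b x *v z - ir_b \<phi> A b x))\<^sup>2 =
    (\<Sum>i\<in>UNIV. right_deriv \<phi> ((ir_y A b x $ i)\<^sup>2) * (ir_y A b z $ i)\<^sup>2)"
proof -
  have "(ir_v \<phi> A b x $ i)\<^sup>2 = right_deriv \<phi> ((ir_y A b x $ i)\<^sup>2)" for i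
    using assumption_A2_right_deriv(2)[OF assms, of "(ir_y A b x $ i)\<^sup>2"]
    by (simp add: ir_v_def right_deriv_vec_def power2_eq_square)
  then have "(ir_v \<phi> A b x * (A *v z - b)) $ i * (ir_v \<phi> A b x * (A *v z - b)) $ i =
      right_deriv \<phi> ((ir_y A b x $ i)\<^sup>2) * (ir_y A b z $ i)\<^sup>2" for i
    by (simp add: ir_y_def power2_eq_square algebra_simps)
  then show ?thesis
    by (simp add: ir_residual power2_norm_eq_inner inner_vec_def)
qed

lemma ir_sigma_eq:
  assumes "assumption_A2 \<phi>"
  shows "ir_sigma \<phi> A b \<sigma> x = \<sigma> - (\<Sum>i\<in>UNIV. \<phi> ((ir_y A b x $ i)\<^sup>2)) +
    (\<Sum>i\<in>UNIV. right_deriv \<phi> ((ir_y A b x $ i)\<^sup>2) * (ir_y A b x $ i)\<^sup>2)"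
  unfolding ir_sigma_def norm_minus_commute[of "ir_b \<phi> A b x"] power2_norm_ir_residual[OF assms]
  by (simp add: Phi_def power2_eq_square)

lemma feasible_set_iff:
  "x \<in> feasible_set \<phi> A b \<sigma> \<longleftrightarrow> (\<Sum>i\<in>UNIV. \<phi> ((ir_y A b x $ i)\<^sup>2)) \<le> \<sigma>"
  by (simp add: feasible_set_def Phi_def ir_y_def power2_eq_square)

lemma subproblem_feasible_subset_feasible_set:
  assumes "assumption_A2 \<phi>"
  shows "subproblem_feasible \<phi> A b \<sigma> x \<subseteq> feasible_set \<phi> A b \<sigma>"
proof
  fix z assume "z \<in> subproblem_feasible \<phi> A b \<sigma> x"
  let ?t = "\<lambda>z i. (ir_y A b z $ i)\<^sup>2"
  have "(\<Sum>i\<in>UNIV. \<phi> (?t z i)) \<le>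
      (\<Sum>i\<in>UNIV. \<phi> (?t x i) + (right_deriv \<phi> (?t x i) * ?t z i - right_deriv \<phi> (?t x i) * ?t x i))"
    using assumption_A2_right_deriv(3)[OF assms]
    by (intro sum_mono) (simp flip: right_diff_distrib)
  \<comment> \<open>Rearranged, this is exactly the constraint of the subproblem.\<close>
  also have "\<dots> \<le> \<sigma>"
    using \<open>z \<in> subproblem_feasible \<phi> A b \<sigma> x\<close>
    by (simp add: subproblem_feasible_def power2_norm_ir_residual[OF assms] ir_sigma_eq[OF assms]
        sum.distrib sum_subtractf)
  finally show "z \<in> feasible_set \<phi> A b \<sigma>"
    by (simp add: feasible_set_iff)
qed

text \<open>The tangent at t is horizontal, so the majorization bounds every value of \<phi> by
  \<open>\<phi> t\<close>.\<close>

lemma phi_sup_eq_of_right_deriv_eq_0: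
  assumes "assumption_A2 \<phi>" "0 \<le> t" "right_deriv \<phi> t = 0"
  shows "phi_sup \<phi> = ereal (\<phi> t)"
  unfolding phi_sup_def
proof (rule antisym)
  show "(SUP s\<in>{0..}. ereal (\<phi> s)) \<le> ereal (\<phi> t)"
    using assumption_A2_right_deriv(3)[OF assms(1,2)] assms(3) by (auto intro!: SUP_least)
  show "ereal (\<phi> t) \<le> (SUP s\<in>{0..}. ereal (\<phi> s))"
    using assms(2) by (auto intro!: SUP_upper)
qed

lemma ir_sigma_pos:
  fixes A :: "real ^ 'n ^ 'm"
  assumes \<phi>: "assumption_A2 \<phi>" and "assumption_A4 CARD('m) \<phi> \<sigma>" and \<sigma>: "0 < \<sigma>"
    and x: "x \<in> feasible_set \<phi> A b \<sigma>"
  shows "0 < ir_sigma \<phi> A b \<sigma> x"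
proof (rule ccontr)
  assume "\<not> 0 < ir_sigma \<phi> A b \<sigma> x"
  define t where "t i = (ir_y A b x $ i)\<^sup>2" for i
  have t: "0 \<le> t i" for i by (simp add: t_def)
  have nn: "0 \<le> right_deriv \<phi> (t i) * t i" for i
    using assumption_A2_right_deriv(2)[OF \<phi> t] t by simp
  then have "0 \<le> (\<Sum>i\<in>UNIV. right_deriv \<phi> (t i) * t i)"
    by (simp add: sum_nonneg)
  moreover have "(\<Sum>i\<in>UNIV. \<phi> (t i)) \<le> \<sigma>"
    using x by (simp add: feasible_set_iff t_def)
  moreover have "\<sigma> - (\<Sum>i\<in>UNIV. \<phi> (t i)) + (\<Sum>i\<in>UNIV. right_deriv \<phi> (t i) * t i) \<le> 0"
    using \<open>\<not> 0 < ir_sigma \<phi> A b \<sigma> x\<close> by (simp add: ir_sigma_eq[OF \<phi>] t_def)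
  \<comment> \<open>Two nonnegative quantities have a sum that is at most 0, so both vanish.\<close>
  ultimately have \<sigma>_eq: "\<sigma> = (\<Sum>i\<in>UNIV. \<phi> (t i))"
    and "(\<Sum>i\<in>UNIV. right_deriv \<phi> (t i) * t i) = 0"
    by linarith+
  then have zero: "right_deriv \<phi> (t i) * t i = 0" for i
    using nn by (simp add: sum_nonneg_eq_0_iff)
  define I where "I = {i. t i \<noteq> 0}"
  have "\<phi> 0 = 0" using \<phi> by (simp add: assumption_A2_def)
  then have \<sigma>_I: "\<sigma> = (\<Sum>i\<in>I. \<phi> (t i))"
    unfolding \<sigma>_eq by (intro sum.mono_neutral_right) (auto simp: I_def)
  \<comment> \<open>\<open>I\<close> is nonempty since \<sigma> > 0, so \<open>card I\<close> is at
    least 1, as (A4) requires of k.\<close>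
  then obtain i0 where i0: "i0 \<in> I" using \<sigma> by fastforce
  have sup: "phi_sup \<phi> = ereal (\<phi> (t i))" if "i \<in> I" for i
    using zero[of i] that by (intro phi_sup_eq_of_right_deriv_eq_0[OF \<phi> t]) (simp add: I_def)
  have "\<phi> (t i) = \<phi> (t i0)" if "i \<in> I" for i
    using sup[OF that] sup[OF i0] by simp
  then have "\<sigma> = real (card I) * \<phi> (t i0)"
    using \<sigma>_I by simp
  then have "ereal \<sigma> = ereal (real (card I)) * phi_sup \<phi>"
    using sup[OF i0] by simp
  moreover have "card I \<in> {1..CARD('m)}"
    using i0 card_gt_0_iff[of I] card_mono[of UNIV I] by (auto simp: Suc_le_eq)
  ultimately show False
    using assms(2) by (auto simp: assumption_A4_def)
qed

lemma ir_residual_pinv: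
  fixes A :: "real ^ 'n ^ 'm"
  assumes "rank A = CARD('m)"
  shows "ir_A \<phi> A b x *v (pinv A *v b) = ir_b \<phi> A b x"
proof -
  have "A *v (pinv A *v b) = b"
    by (simp add: matrix_vector_mul_assoc full_row_rank_pinv[OF assms])
  then show ?thesis
    using ir_residual[of \<phi> A b x "pinv A *v b"] by simp
qed

text \<open>The residual is affine in z and vanishes at \<open>pinv A *v b\<close>, so combining
  with weights \<open>1 - \<rho>\<close> and \<open>\<rho>\<close> multiplies it by
  \<open>\<rho>\<close>, chosen to bring its squared norm to \<open>ir_sigma\<close>.\<close>

lemma ir_P_subproblem_feasible:
  fixes A :: "real ^ 'n ^ 'm"
  assumes rank: "rank A = CARD('m)" and pos: "0 < ir_sigma \<phi> A b \<sigma> x"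
  shows "ir_P \<phi> A b \<sigma> x z \<in> subproblem_feasible \<phi> A b \<sigma> x"
proof (cases "(norm (ir_A \<phi> A b x *v z - ir_b \<phi> A b x))\<^sup>2 \<le> ir_sigma \<phi> A b \<sigma> x")
  case True
  then show ?thesis by (simp add: ir_P_def subproblem_feasible_def)
next
  case False
  define r where "r = ir_A \<phi> A b x *v z - ir_b \<phi> A b x"
  define \<rho> where "\<rho> = sqrt (ir_sigma \<phi> A b \<sigma> x) / norm r"
  have "r \<noteq> 0" using False pos by (auto simp: r_def)
  have "ir_P \<phi> A b \<sigma> x z = (1 - \<rho>) *\<^sub>R (pinv A *v b) + \<rho> *\<^sub>R z"
    using False by (simp add: ir_P_def \<rho>_def r_def Let_def)
  then have "ir_A \<phi> A b x *v ir_P \<phi> A b \<sigma> x z - ir_b \<phi> A b x = \<rho> *\<^sub>R r"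
    by (simp only:) (simp add: ir_residual_pinv[OF rank] r_def algebra_simps)
  moreover have "(norm (\<rho> *\<^sub>R r))\<^sup>2 = ir_sigma \<phi> A b \<sigma> x"
    using \<open>r \<noteq> 0\<close> pos by (simp add: \<rho>_def)
  ultimately show ?thesis by (simp add: subproblem_feasible_def)
qed

section \<open>Carrying out the steps of one iteration\<close>

lemma ir_step1_defined:
  assumes "assumption_A1 \<psi>" "assumption_A2 \<phi>"
  shows "ir_step1_defined \<phi> \<psi> A b x"
  using assumption_A1_right_deriv(1)[OF assms(1)] assumption_A2_right_deriv(1,2)[OF assms(2)]
  by (simp add: ir_step1_defined_def abs_vec_def)

lemma ex_ir_tolerance:
  assumes "0 < ir_sigma \<phi> A b \<sigma> x" "0 < \<tau>k"
  shows "\<exists>\<epsilon>. ir_tolerance \<phi> A b \<sigma> \<tau>k x \<epsilon>"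
  using assms
  by (auto simp: ir_tolerance_def
      intro!: exI[of _ "Min {ir_sigma \<phi> A b \<sigma> x, sqrt (ir_sigma \<phi> A b \<sigma> x), \<tau>k}"])

text \<open>At z = x the squared residual stands on both sides of the constraint and
  cancels.\<close>

lemma feasible_set_imp_subproblem_feasible:
  assumes "x \<in> feasible_set \<phi> A b \<sigma>"
  shows "x \<in> subproblem_feasible \<phi> A b \<sigma> x"
  using assms
  by (simp add: feasible_set_def subproblem_feasible_def ir_sigma_def ir_y_def
      norm_minus_commute[of "ir_b \<phi> A b x"])

text \<open>An exact solution z with its own residual as \<open>ut\<close> serves: (C2) holds with
  error 0, and (C3) holds since \<open>ir_P\<close> fixes z and x is a competitor in the
  subproblem.\<close>

lemma ex_ir_pair:
  fixes A :: "real ^ 'n ^ 'm"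
  assumes \<psi>: "assumption_A1 \<psi>" and rank: "rank A = CARD('m)"
    and pos: "0 < ir_sigma \<phi> A b \<sigma> x" and x: "x \<in> feasible_set \<phi> A b \<sigma>"
    and "0 \<le> \<epsilon>" "0 \<le> \<mu>k"
  shows "\<exists>xt ut. ir_pair \<phi> \<psi> A b \<sigma> \<mu>k x \<epsilon> xt ut"
proof -
  let ?M = "ir_A \<phi> A b x" and ?c = "ir_b \<phi> A b x" and ?s = "ir_sigma \<phi> A b \<sigma> x" and ?w = "ir_w \<psi> x"
  have w: "0 < ?w $ i" for i
    using assumption_A1_right_deriv(2)[OF \<psi>] by (simp add: ir_w_def right_deriv_vec_def abs_vec_def)
  have x': "(norm (?M *v x - ?c))\<^sup>2 \<le> ?s"
    using feasible_set_imp_subproblem_feasible[OF x] by (simp add: subproblem_feasible_def)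
  obtain z where z: "(norm (?M *v z - ?c))\<^sup>2 \<le> ?s"
    and opt: "\<And>y. (norm (?M *v y - ?c))\<^sup>2 \<le> ?s \<Longrightarrow> l1_norm (?w * z) \<le> l1_norm (?w * y)"
    using weighted_l1_minimizer[OF w x'] by blast
  have "(norm (?M *v (pinv A *v b) - ?c))\<^sup>2 < ?s"
    using pos by (simp add: ir_residual_pinv[OF rank])
  from weighted_l1_kkt[OF w this z opt] obtain \<xi> \<nu> where
    "\<xi> \<in> subdifferential l1_norm z" "\<nu> \<in> normal_cone {v. (norm v)\<^sup>2 \<le> ?s} (?M *v z - ?c)"
    "?w * \<xi> + transpose ?M *v \<nu> = 0"
    by blast
  \<comment> \<open>The KKT equation puts 0 itself into the set whose distance from 0 is
    measured.\<close>
  then have "cond_C1 \<phi> \<psi> A b \<sigma> x \<epsilon> z (?M *v z - ?c)"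
    unfolding cond_C1_def ext_infdist_def using \<open>0 \<le> \<epsilon>\<close> by (intro INF_lower2[of 0]) fastforce+
  moreover have "cond_C2 \<phi> A b x \<epsilon> z (?M *v z - ?c)"
    using \<open>0 \<le> \<epsilon>\<close> by (simp add: cond_C2_def)
  moreover have "ir_P \<phi> A b \<sigma> x z = z"
    using z by (simp add: ir_P_def)
  then have "cond_C3 \<phi> \<psi> A b \<sigma> x \<mu>k z"
    using opt[OF x'] \<open>0 \<le> \<mu>k\<close> by (simp add: cond_C3_def)
  ultimately show ?thesis unfolding ir_pair_def by blast
qed

theorem mainTheorem2:
  fixes \<phi> \<psi> :: "real \<Rightarrow> real"
    and A :: "real ^ 'n ^ 'm" and b :: "real ^ 'm" and \<sigma> :: real
    and \<tau> \<mu> :: "nat \<Rightarrow> real"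
  assumes "assumption_A1 \<psi>"
    and "assumption_A2 \<phi>"
    and "assumption_A3 \<phi> A b \<sigma>"
    and "assumption_A4 CARD('m) \<phi> \<sigma>"
    and "ir_parameters \<tau> \<mu>"
  shows "(\<forall>k. \<forall>x \<in> feasible_set \<phi> A b \<sigma>.
            0 < ir_sigma \<phi> A b \<sigma> x \<and>
            (\<exists>\<epsilon>. ir_tolerance \<phi> A b \<sigma> (\<tau> k) x \<epsilon>) \<and>
            subproblem_feasible \<phi> A b \<sigma> x \<noteq> {} \<and>
            (norm (ir_A \<phi> A b x *v (pinv A *v b) - ir_b \<phi> A b x))\<^sup>2 < ir_sigma \<phi> A b \<sigma> x \<and>
            (\<forall>\<epsilon>. ir_tolerance \<phi> A b \<sigma> (\<tau> k) x \<epsilon> \<longrightarrow>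
               (\<exists>xt ut. ir_pair \<phi> \<psi> A b \<sigma> (\<mu> k) x \<epsilon> xt ut) \<and>
               (\<forall>xt ut. ir_pair \<phi> \<psi> A b \<sigma> (\<mu> k) x \<epsilon> xt ut \<longrightarrow>
                  ir_P \<phi> A b \<sigma> x xt \<in> feasible_set \<phi> A b \<sigma>)))
         \<and> ir_well_defined \<phi> \<psi> A b \<sigma> \<tau> \<mu>"
proof -
  let ?F = "feasible_set \<phi> A b \<sigma>"
  have rank: "rank A = CARD('m)" and \<sigma>: "0 < \<sigma>"
    using assms(3) by (auto simp: assumption_A3_def)
  have \<tau>: "0 < \<tau> k" and \<mu>: "0 < \<mu> k" for k
    using assms(5) by (auto simp: ir_parameters_def)
  have step1: "ir_step1_defined \<phi> \<psi> A b x" for x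
    by (rule ir_step1_defined[OF assms(1,2)])
  have pos: "0 < ir_sigma \<phi> A b \<sigma> x" if "x \<in> ?F" for x
    by (rule ir_sigma_pos[OF assms(2,4) \<sigma> that])
  have tol: "\<exists>\<epsilon>. ir_tolerance \<phi> A b \<sigma> (\<tau> k) x \<epsilon>" if "x \<in> ?F" for k x
    by (rule ex_ir_tolerance[OF pos[OF that] \<tau>])
  have slater: "(norm (ir_A \<phi> A b x *v (pinv A *v b) - ir_b \<phi> A b x))\<^sup>2 < ir_sigma \<phi> A b \<sigma> x"
    if "x \<in> ?F" for x
    using pos[OF that] by (simp add: ir_residual_pinv[OF rank])
  have pair: "\<exists>xt ut. ir_pair \<phi> \<psi> A b \<sigma> (\<mu> k) x \<epsilon> xt ut"
    if "x \<in> ?F" "ir_tolerance \<phi> A b \<sigma> (\<tau> k) x \<epsilon>" for k x \<epsilon>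
    using that(2) \<mu>[of k]
    by (intro ex_ir_pair[OF assms(1) rank pos[OF that(1)] that(1)]) (auto simp: ir_tolerance_def)
  have next_feasible: "ir_P \<phi> A b \<sigma> x xt \<in> ?F" if "x \<in> ?F" for x xt
    using ir_P_subproblem_feasible[OF rank pos[OF that]]
      subproblem_feasible_subset_feasible_set[OF assms(2)] by blast
  have "ir_well_defined \<phi> \<psi> A b \<sigma> \<tau> \<mu>"
    unfolding ir_well_defined_def
  proof (intro conjI allI ballI impI; (elim conjE)?)
    fix N X E Xt Ut
    assume X0: "X 0 \<in> ?F"
      and run: "\<forall>k<N. ir_iteration \<phi> \<psi> A b \<sigma> (\<tau> k) (\<mu> k) (X k) (E k) (Xt k) (Ut k) (X (Suc k))"
    \<comment> \<open>Feasibility is the invariant of every partial run, whatever choices were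
      made.\<close>
    have "X k \<in> ?F" if "k \<le> N" for k
      using that
    proof (induction k)
      case (Suc k)
      then have "X (Suc k) = ir_P \<phi> A b \<sigma> (X k) (Xt k)"
        using run by (simp add: ir_iteration_def)
      with Suc show ?case using next_feasible by simp
    qed (rule X0)
    then have XN: "X N \<in> ?F" by simp
    show "ir_step1_defined \<phi> \<psi> A b (X N)" by (rule step1)
    show "\<exists>\<epsilon>. ir_tolerance \<phi> A b \<sigma> (\<tau> N) (X N) \<epsilon>" by (rule tol[OF XN])
    show "\<exists>xt ut. ir_pair \<phi> \<psi> A b \<sigma> (\<mu> N) (X N) \<epsilon> xt ut"
      if "ir_tolerance \<phi> A b \<sigma> (\<tau> N) (X N) \<epsilon>" for \<epsilon>
      by (rule pair[OF XN that])
  next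
    fix x0 assume x0: "x0 \<in> ?F"
    \<comment> \<open>Feasibility of \<open>x'\<close> is carried along so that dependent choice can
      continue from it.\<close>
    have "\<exists>x' \<epsilon> xt ut. x' \<in> ?F \<and> ir_iteration \<phi> \<psi> A b \<sigma> (\<tau> k) (\<mu> k) x \<epsilon> xt ut x'"
      if "x \<in> ?F" for k x
      using tol[OF that] pair[OF that] next_feasible[OF that] step1
      unfolding ir_iteration_def by metis
    \<comment> \<open>The clause for k = 0 in the state predicate pins the starting point; the other
      choices of each iteration are extracted afterwards.\<close>
    then have "\<exists>X. \<forall>k. (X k \<in> ?F \<and> (k = 0 \<longrightarrow> X k = x0)) \<and>
        (\<exists>\<epsilon> xt ut. ir_iteration \<phi> \<psi> A b \<sigma> (\<tau> k) (\<mu> k) (X k) \<epsilon> xt ut (X (Suc k)))"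
      using x0 by (intro dependent_nat_choice) auto
    then obtain X where "X 0 = x0"
      "\<forall>k. \<exists>\<epsilon> xt ut. ir_iteration \<phi> \<psi> A b \<sigma> (\<tau> k) (\<mu> k) (X k) \<epsilon> xt ut (X (Suc k))"
      by blast
    then show "\<exists>X E Xt Ut. X 0 = x0 \<and>
        (\<forall>k. ir_iteration \<phi> \<psi> A b \<sigma> (\<tau> k) (\<mu> k) (X k) (E k) (Xt k) (Ut k) (X (Suc k)))"
      by metis
  qed
  moreover have "subproblem_feasible \<phi> A b \<sigma> x \<noteq> {}" if "x \<in> ?F" for x
    using feasible_set_imp_subproblem_feasible[OF that] by blast
  ultimately show ?thesis
    using pos tol slater pair next_feasible by blast
qed

end
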